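(* Let $q\in\mathbb{C}$ with $0<|q|<1$, let $\alpha\in\mathbb{N}$, $m\in\mathbb{N}$, $n\in\mathbb{N}_0$ and $x,y\in\mathbb{C}$. Then the $q$-Genocchi polynomials of order $\alpha$ and the $q$-Bernoulli polynomials satisfy $$\mathfrak{G}_{n,q}^{(\alpha)}(x,y)=\sum_{k=0}^{n}\begin{bmatrix} n \\ k \end{bmatrix}_q\frac{1}{m^{n-k-1}[k+1]_q}\left[2[k+1]_q\sum_{j=0}^{k}\begin{bmatrix} k \\ j \end{bmatrix}_q\frac{1}{m^{k-j}}\mathfrak{G}_{j,q}^{(\alpha-1)}(x,-1)-\sum_{j=0}^{k+1}\begin{bmatrix} k+1 \\ j \end{bmatrix}_q\frac{1}{m^{k+1-j}}\mathfrak{G}_{j,q}^{(\alpha)}(x,-1)-\mathfrak{G}_{k+1,q}^{(\alpha)}(x,0)\right]\mathfrak{B}_{n-k,q}(0,my).$$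
   Context: $\mathbb{N}=\{1,2,\dots\}$, $\mathbb{N}_0=\{0,1,2,\dots\}$. For $0<|q|<1$: $[a]_q=\frac{1-q^a}{1-q}$, $[0]_q!=1$, $[n]_q!=[1]_q[2]_q\cdots[n]_q$, and $\begin{bmatrix} n \\ k \end{bmatrix}_q=\frac{[n]_q!}{[k]_q!\,[n-k]_q!}$. The two $q$-exponential functions are $$e_q(z)=\sum_{n=0}^\infty\frac{z^n}{[n]_q!},\qquad E_q(z)=\sum_{n=0}^\infty\frac{q^{n(n-1)/2}z^n}{[n]_q!}.$$ For $\alpha\in\mathbb{N}_0$ the $q$-Genocchi polynomials $\mathfrak{G}_{n,q}^{(\alpha)}(x,y)$ of order $\alpha$ and the $q$-Bernoulli polynomials $\mathfrak{B}_{n,q}^{(\alpha)}(x,y)$ of order $\alpha$ are defined by the power series expansions in $t$ at $t=0$ $$\left(\frac{2t}{e_q(t)+1}\right)^{\alpha}e_q(tx)E_q(ty)=\sum_{n=0}^\infty\mathfrak{G}_{n,q}^{(\alpha)}(x,y)\frac{t^n}{[n]_q!},\qquad \left(\frac{t}{e_q(t)-1}\right)^{\alpha}e_q(tx)E_q(ty)=\sum_{n=0}^\infty\mathfrak{B}_{n,q}^{(\alpha)}(x,y)\frac{t^n}{[n]_q!}.$$ When the superscript is omitted, the order is $\alpha=1$: $\mathfrak{B}_{n,q}(x,y)=\mathfrak{B}_{n,q}^{(1)}(x,y)$. *)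

theory Defs
  imports "HOL-Complex_Analysis.Complex_Analysis"
begin

definition q_bracket :: "complex \<Rightarrow> nat \<Rightarrow> complex" where
  "q_bracket q a = (1 - q ^ a) / (1 - q)"

definition q_fact :: "complex \<Rightarrow> nat \<Rightarrow> complex" where
  "q_fact q n = (\<Prod>i=1..n. q_bracket q i)"

text \<open>Only meaningful for \<open>k \<le> n\<close>, because of the truncated subtraction.\<close>

definition q_binomial :: "complex \<Rightarrow> nat \<Rightarrow> nat \<Rightarrow> complex" where
  "q_binomial q n k = q_fact q n / (q_fact q k * q_fact q (n - k))"

definition e_q :: "complex \<Rightarrow> complex \<Rightarrow> complex" where
  "e_q q z = (\<Sum>n. z ^ n / q_fact q n)"

definition E_q :: "complex \<Rightarrow> complex \<Rightarrow> complex" where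
  "E_q q z = (\<Sum>n. q ^ (n * (n - 1) div 2) * z ^ n / q_fact q n)"

text \<open>
  The coefficients \<open>a n\<close> in the expansion of \<open>f t\<close> as the sum of \<open>a n * t ^ n / [n]!\<close> at
  \<open>t = 0\<close>. The point \<open>t = 0\<close> itself is excluded since \<open>t / (e_q q t - 1)\<close> has a removable
  singularity there (and the value 0 in HOL); the coefficients are determined by the values
  at \<open>t \<noteq> 0\<close> near 0.
\<close>

definition q_expansion_coeffs :: "complex \<Rightarrow> (complex \<Rightarrow> complex) \<Rightarrow> nat \<Rightarrow> complex" where
  "q_expansion_coeffs q f =
     (THE a. eventually (\<lambda>t. (\<lambda>n. a n * (t ^ n / q_fact q n)) sums f t) (at 0))"

definition q_Genocchi :: "complex \<Rightarrow> nat \<Rightarrow> nat \<Rightarrow> complex \<Rightarrow> complex \<Rightarrow> complex" where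
  "q_Genocchi q \<alpha> n x y =
     q_expansion_coeffs q
       (\<lambda>t. (2 * t / (e_q q t + 1)) ^ \<alpha> * e_q q (t * x) * E_q q (t * y)) n"

definition q_Bernoulli :: "complex \<Rightarrow> nat \<Rightarrow> nat \<Rightarrow> complex \<Rightarrow> complex \<Rightarrow> complex" where
  "q_Bernoulli q \<alpha> n x y =
     q_expansion_coeffs q
       (\<lambda>t. (t / (e_q q t - 1)) ^ \<alpha> * e_q q (t * x) * E_q q (t * y)) n"


subsection \<open>The expansions exist and are unique\<close>

lemma q_bracket_nonzero:
  assumes "norm q < 1" "n > 0"
  shows   "q_bracket q n \<noteq> 0"
proof -
  have "norm (q ^ n) < 1"
    using assms by (simp add: norm_power power_less_one_iff)
  hence "q ^ n \<noteq> 1" by auto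
  moreover have "q \<noteq> 1" using assms by auto
  ultimately show ?thesis by (simp add: q_bracket_def)
qed

lemma q_fact_nonzero: "norm q < 1 \<Longrightarrow> q_fact q n \<noteq> 0"
  unfolding q_fact_def using q_bracket_nonzero by auto

lemma norm_inverse_q_fact_le:
  assumes "norm q < 1"
  shows   "norm (1 / q_fact q n) \<le> (2 / (1 - norm q)) ^ n"
proof -
  have "norm (1 / q_bracket q i) \<le> 2 / (1 - norm q)" if "i \<in> {1..n}" for i
  proof -
    have "norm (q ^ i) \<le> norm q"
      using that assms power_decreasing[of 1 i "norm q"] by (simp add: norm_power)
    moreover have "norm (1 - q ^ i) \<ge> 1 - norm (q ^ i)"
      using norm_triangle_ineq2[of 1 "q ^ i"] by simp
    ultimately have "norm (1 - q ^ i) \<ge> 1 - norm q" by linarith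
    moreover have "norm (1 - q) \<le> 2"
      using norm_triangle_ineq4[of 1 q] assms by simp
    ultimately show ?thesis
      using assms by (auto simp: q_bracket_def norm_divide intro!: frac_le)
  qed
  hence "(\<Prod>i=1..n. norm (1 / q_bracket q i)) \<le> (\<Prod>i=1..n. 2 / (1 - norm q))"
    by (intro prod_mono) auto
  thus ?thesis
    by (simp add: q_fact_def norm_divide prod_norm prod_dividef)
qed

lemma has_fps_expansion_q_series:
  assumes "norm q < 1" "\<And>n. norm (c n) \<le> 1"
  shows   "(\<lambda>z. \<Sum>n. c n * z ^ n / q_fact q n) has_fps_expansion Abs_fps (\<lambda>n. c n / q_fact q n)"
proof -
  define C where "C = 2 / (1 - norm q)"
  have C: "C > 0" using assms by (simp add: C_def)
  define z :: complex where "z = of_real (1 / (2 * C))"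
  have "summable (\<lambda>n. (1 / 2 :: real) ^ n)"
    by (intro summable_geometric) auto
  hence "summable (\<lambda>n. c n / q_fact q n * z ^ n)"
  proof (rule summable_comparison_test')
    fix n
    have "norm (c n / q_fact q n * z ^ n) = norm (c n) * norm (1 / q_fact q n) * norm z ^ n"
      by (simp add: norm_mult norm_divide norm_power)
    also have "\<dots> \<le> 1 * C ^ n * norm z ^ n"
      unfolding C_def using assms norm_inverse_q_fact_le[of q n]
      by (intro mult_mono) auto
    also have "\<dots> = (1 / 2) ^ n"
      using C by (simp add: z_def norm_divide norm_mult power_mult_distrib [symmetric])
    finally show "norm (c n / q_fact q n * z ^ n) \<le> (1 / 2) ^ n" .
  qed
  hence "fps_conv_radius (Abs_fps (\<lambda>n. c n / q_fact q n)) \<ge> norm z"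
    unfolding fps_conv_radius_def by (intro conv_radius_geI) (simp only: fps_nth_Abs_fps)
  moreover have "norm z > 0" using C by (simp add: z_def)
  ultimately have "fps_conv_radius (Abs_fps (\<lambda>n. c n / q_fact q n)) > 0"
    by (metis ereal_less(2) less_le_trans)
  thus ?thesis
    by (simp add: has_fps_expansion_def eval_fps_def)
qed

definition e_q_fps :: "complex \<Rightarrow> complex fps" where
  "e_q_fps q = Abs_fps (\<lambda>n. 1 / q_fact q n)"

definition E_q_fps :: "complex \<Rightarrow> complex fps" where
  "E_q_fps q = Abs_fps (\<lambda>n. q ^ (n * (n - 1) div 2) / q_fact q n)"

lemma has_fps_expansion_e_q: "norm q < 1 \<Longrightarrow> e_q q has_fps_expansion e_q_fps q"
  using has_fps_expansion_q_series[of q "\<lambda>_. 1"] by (simp add: e_q_def [abs_def] e_q_fps_def)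

lemma has_fps_expansion_E_q: "norm q < 1 \<Longrightarrow> E_q q has_fps_expansion E_q_fps q"
  using has_fps_expansion_q_series[of q "\<lambda>n. q ^ (n * (n - 1) div 2)"]
  by (simp add: E_q_def [abs_def] E_q_fps_def norm_power power_le_one)

lemma has_fps_expansion_compose_scale:
  fixes f :: "complex \<Rightarrow> complex"
  assumes "f has_fps_expansion F"
  shows   "(\<lambda>t. f (t * c)) has_fps_expansion fps_compose F (fps_X * fps_const c)"
proof -
  have "(\<lambda>t. t * c) has_fps_expansion fps_X * fps_const c"
    by (intro fps_expansion_intros)
  from has_fps_expansion_compose[OF assms this] show ?thesis by (simp add: o_def)
qed

lemma q_expansion_unique:
  assumes q: "norm q < 1"
  assumes a: "eventually (\<lambda>t. (\<lambda>n. a n * (t ^ n / q_fact q n)) sums f t) (at 0)"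
  assumes b: "eventually (\<lambda>t. (\<lambda>n. b n * (t ^ n / q_fact q n)) sums f t) (at 0)"
  shows   "a = b"
proof -
  have L: "f has_laurent_expansion fps_to_fls (Abs_fps (\<lambda>n. a n / q_fact q n))"
    if ev: "eventually (\<lambda>t. (\<lambda>n. a n * (t ^ n / q_fact q n)) sums f t) (at 0)" for a
  proof -
    define F where "F = Abs_fps (\<lambda>n. a n / q_fact q n)"
    define g where "g = (\<lambda>t. if t = 0 then fps_nth F 0 else f t)"
    have "eventually (\<lambda>t. (\<lambda>n. fps_nth F n * t ^ n) sums g t) (nhds 0)"
      using ev unfolding eventually_at_filter
    proof eventually_elim
      case (elim t)
      show ?case
      proof (cases "t = 0")
        case True
        thus ?thesis using powser_sums_zero[of "fps_nth F"] by (simp add: g_def)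
      next
        case False
        thus ?thesis using elim by (simp add: g_def F_def)
      qed
    qed
    hence "g has_fps_expansion F" by (rule has_fps_expansionI)
    hence "g has_laurent_expansion fps_to_fls F" by (rule has_laurent_expansion_fps)
    also have "?this \<longleftrightarrow> f has_laurent_expansion fps_to_fls F"
      by (intro has_laurent_expansion_cong) (auto simp: g_def eventually_at_filter)
    finally show ?thesis by (simp add: F_def)
  qed
  have "fps_to_fls (Abs_fps (\<lambda>n. a n / q_fact q n)) = fps_to_fls (Abs_fps (\<lambda>n. b n / q_fact q n))"
    using L[OF a] L[OF b] by (rule has_laurent_expansion_unique)
  hence "a n / q_fact q n = b n / q_fact q n" for n
    by (metis fps_to_fls_eq_iff fps_nth_Abs_fps)
  thus ?thesis using q_fact_nonzero[OF q] by auto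
qed

lemma q_expansion_coeffs_eqI:
  assumes q: "norm q < 1"
  assumes a: "eventually (\<lambda>t. (\<lambda>n. a n * (t ^ n / q_fact q n)) sums f t) (at 0)"
  shows   "q_expansion_coeffs q f = a"
  unfolding q_expansion_coeffs_def using a q_expansion_unique[OF q] by blast

lemma sums_q_expansion_coeffs:
  assumes q: "norm q < 1" and g: "g has_fps_expansion F"
    and eq: "eventually (\<lambda>t. f t = g t) (at 0)"
  shows   "q_expansion_coeffs q f = (\<lambda>n. fps_nth F n * q_fact q n)"
    and   "eventually (\<lambda>t. (\<lambda>n. q_expansion_coeffs q f n * (t ^ n / q_fact q n)) sums f t) (at 0)"
proof -
  have "eventually (\<lambda>t. t \<in> eball 0 (fps_conv_radius F)) (nhds 0)"
    using g by (intro eventually_nhds_in_open) (auto simp: has_fps_expansion_def zero_ereal_def)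
  hence "eventually (\<lambda>t. (\<lambda>n. fps_nth F n * t ^ n) sums eval_fps F t) (nhds 0)"
    by eventually_elim (intro sums_eval_fps, simp)
  moreover have "eventually (\<lambda>t. eval_fps F t = g t) (nhds 0)"
    using g by (simp add: has_fps_expansion_def)
  ultimately have "eventually (\<lambda>t. (\<lambda>n. fps_nth F n * t ^ n) sums g t) (nhds 0)"
    by eventually_elim simp
  hence "eventually (\<lambda>t. (\<lambda>n. fps_nth F n * t ^ n) sums g t) (at 0)"
    by (simp add: eventually_at_filter eventually_mono)
  with eq have *: "eventually (\<lambda>t. (\<lambda>n. (fps_nth F n * q_fact q n) * (t ^ n / q_fact q n)) sums f t) (at 0)"
    by eventually_elim (simp add: q_fact_nonzero[OF q])
  show coeffs: "q_expansion_coeffs q f = (\<lambda>n. fps_nth F n * q_fact q n)"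
    by (rule q_expansion_coeffs_eqI[OF q *])
  show "eventually (\<lambda>t. (\<lambda>n. q_expansion_coeffs q f n * (t ^ n / q_fact q n)) sums f t) (at 0)"
    unfolding coeffs by (rule *)
qed

theorem q_Genocchi_expansion:
  assumes q: "norm q < 1"
  shows "eventually (\<lambda>t. (\<lambda>n. q_Genocchi q \<alpha> n x y * (t ^ n / q_fact q n)) sums
           ((2 * t / (e_q q t + 1)) ^ \<alpha> * e_q q (t * x) * E_q q (t * y))) (at 0)"
proof -
  have "(\<lambda>t. (2 * t / (e_q q t + 1)) ^ \<alpha> * e_q q (t * x) * E_q q (t * y)) has_fps_expansion
          (2 * fps_X / (e_q_fps q + 1)) ^ \<alpha> * fps_compose (e_q_fps q) (fps_X * fps_const x) *
          fps_compose (E_q_fps q) (fps_X * fps_const y)"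
    by (intro fps_expansion_intros has_fps_expansion_compose_scale
          has_fps_expansion_e_q has_fps_expansion_E_q q)
       (simp add: e_q_fps_def q_fact_def)
  from sums_q_expansion_coeffs(2)[OF q this] show ?thesis
    by (simp add: q_Genocchi_def)
qed

theorem q_Bernoulli_expansion:
  assumes q: "norm q < 1"
  shows "eventually (\<lambda>t. (\<lambda>n. q_Bernoulli q \<alpha> n x y * (t ^ n / q_fact q n)) sums
           ((t / (e_q q t - 1)) ^ \<alpha> * e_q q (t * x) * E_q q (t * y))) (at 0)"
proof -
  have nz: "fps_nth (e_q_fps q - 1) 0 = 0" "fps_nth (e_q_fps q - 1) 1 \<noteq> 0"
    using q_fact_nonzero[OF q, of 1] by (simp_all add: e_q_fps_def q_fact_def)
  hence sub: "subdegree (e_q_fps q - 1) = 1"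
    by (intro subdegreeI) auto
  define c where "c = 1 / fps_nth (e_q_fps q - 1) 1"
  have "(\<lambda>t. if t = 0 then c else t / (e_q q t - 1)) has_fps_expansion fps_X / (e_q_fps q - 1)"
    using nz sub by (intro fps_expansion_intros has_fps_expansion_e_q q) (auto simp: c_def)
  hence "(\<lambda>t. (if t = 0 then c else t / (e_q q t - 1)) ^ \<alpha> * e_q q (t * x) * E_q q (t * y))
           has_fps_expansion
          (fps_X / (e_q_fps q - 1)) ^ \<alpha> * fps_compose (e_q_fps q) (fps_X * fps_const x) *
          fps_compose (E_q_fps q) (fps_X * fps_const y)"
    by (intro has_fps_expansion_mult has_fps_expansion_power has_fps_expansion_compose_scale
          has_fps_expansion_e_q has_fps_expansion_E_q q)
  from sums_q_expansion_coeffs(2)[OF q this] show ?thesis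
    by (simp add: q_Bernoulli_def eventually_at_filter)
qed

end

(* In the ring of formal power series, put A = 2t/(e(t) + 1) and let e, E be the two q-exponential
   series. By their q-difference equations e(t) E(-t) is invariant under t -> qt, hence equal to 1. Thus
   2t e(t/m) A^(a-1) e(tx) E(-t) - e(t/m) A^a e(tx) E(-t)
   - A^a e(tx) equals A^a e(tx) (e(t/m) - 1). The Bernoulli series with argument my, taken at t/m,
   is (t/m) E(ty) / (e(t/m) - 1), so multiplying the two cancels e(t/m) - 1 and leaves (t/m) times
   the Genocchi series. The theorem compares coefficients of t^(n+1). *)
theory Submission
  imports Defs
begin

section \<open>Substitution t -> ct in formal power series\<close>

abbreviation fps_scale :: "'a :: comm_ring_1 fps \<Rightarrow> 'a \<Rightarrow> 'a fps" where
  "fps_scale F c \<equiv> fps_compose F (fps_X * fps_const c)"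

lemma fps_nth_scale: "fps_nth (fps_scale F c) n = c ^ n * fps_nth F n"
  using fps_compose_linear[of F c] by (simp add: mult.commute)

lemma fps_scale_mult:
  fixes F G :: "'a :: idom fps"
  shows "fps_scale (F * G) c = fps_scale F c * fps_scale G c"
  by (simp add: fps_compose_mult_distrib)

lemma fps_scale_scale: "fps_scale (fps_scale F c) d = fps_scale F (c * d)"
  by (simp add: fps_eq_iff fps_nth_scale power_mult_distrib mult_ac)

section \<open>The q-exponential series and their product\<close>

lemma q_fact_0 [simp]: "q_fact q 0 = 1"
  by (simp add: q_fact_def)

lemma q_fact_Suc: "q_fact q (Suc n) = q_fact q n * q_bracket q (Suc n)"
  by (simp add: q_fact_def)

lemma e_q_fps_nth_0 [simp]: "fps_nth (e_q_fps q) 0 = 1"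
  by (simp add: e_q_fps_def)

lemma E_q_fps_nth_0 [simp]: "fps_nth (E_q_fps q) 0 = 1"
  by (simp add: E_q_fps_def)

text \<open>Invariance multiplies the n-th coefficient by q^n, and q^n is not 1 for n > 0, so only
  the constant term survives.\<close>

lemma fps_eq_1_if_q_invariant:
  fixes q :: complex
  assumes "norm q < 1" "fps_scale F q = F" "fps_nth F 0 = 1"
  shows   "F = 1"
proof (rule fps_ext)
  fix n
  show "fps_nth F n = fps_nth 1 n"
  proof (cases "n = 0")
    case False
    hence "norm (q ^ n) < 1"
      using assms(1) by (simp add: norm_power power_less_one_iff)
    hence "q ^ n \<noteq> 1" by auto
    moreover have "q ^ n * fps_nth F n = fps_nth F n"
      using assms(2) by (metis fps_nth_scale)
    ultimately show ?thesis using False by simp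
  qed (use assms in simp)
qed

text \<open>The q-difference equation of e; on coefficients it is (1 - q) [n] = 1 - q^n.\<close>

lemma e_q_fps_scale:
  assumes "norm q < 1"
  shows   "fps_scale (e_q_fps q) q = (1 - fps_const (1 - q) * fps_X) * e_q_fps q"
proof (rule fps_ext)
  fix n
  have q1: "1 - q \<noteq> 0" using assms by auto
  show "fps_nth (fps_scale (e_q_fps q) q) n = fps_nth ((1 - fps_const (1 - q) * fps_X) * e_q_fps q) n"
  proof (cases n)
    case (Suc k)
    show ?thesis
      using q_fact_nonzero[OF assms, of k] q_bracket_nonzero[OF assms, of "Suc k"] q1
      unfolding Suc fps_nth_scale
      by (simp add: left_diff_distrib mult.assoc fps_nth_scale e_q_fps_def q_fact_Suc q_bracket_def
               divide_simps) (simp add: algebra_simps)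
  qed (simp add: fps_nth_scale left_diff_distrib mult.assoc)
qed

text \<open>Under t -> qt the series e(t) acquires the factor 1 - (1 - q)t; here E(-qt) absorbs the
  same factor and becomes E(-t).\<close>

lemma E_q_fps_scale_minus:
  assumes "norm q < 1"
  shows   "fps_scale (E_q_fps q) (-1) =
             (1 - fps_const (1 - q) * fps_X) * fps_scale (E_q_fps q) (- q)"
proof (rule fps_ext)
  fix n
  have q1: "1 - q \<noteq> 0" using assms by auto
  show "fps_nth (fps_scale (E_q_fps q) (-1)) n =
          fps_nth ((1 - fps_const (1 - q) * fps_X) * fps_scale (E_q_fps q) (- q)) n"
  proof (cases n)
    case (Suc k)
    have tri: "Suc k * (Suc k - 1) div 2 = k * (k - 1) div 2 + k"
      by (cases k) simp_all
    define T where "T = q ^ (k * (k - 1) div 2)"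
    define f where "f = q_fact q k"
    define b where "b = q_bracket q (Suc k)"
    have nz: "f \<noteq> 0" "b \<noteq> 0"
      using q_fact_nonzero[OF assms] q_bracket_nonzero[OF assms] by (auto simp: f_def b_def)
    have b: "b * (1 - q) = 1 - q ^ Suc k"
      using q1 by (simp add: b_def q_bracket_def)
    have "(-1) ^ Suc k * (T * q ^ k / (f * b)) =
            (- q) ^ Suc k * (T * q ^ k / (f * b)) - (1 - q) * ((- q) ^ k * (T / f))"
    proof -
      \<comment> \<open>The left side is pulled out as a common factor; the cofactor is 1 by the
        fact \<open>b\<close>.\<close>
      have "(- q) ^ Suc k * (T * q ^ k / (f * b)) - (1 - q) * ((- q) ^ k * (T / f)) =
              (-1) ^ Suc k * (T * q ^ k / (f * b)) * (q ^ Suc k + b * (1 - q))"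
        using nz by (simp add: power_minus[of q] divide_simps) (simp add: algebra_simps)
      thus ?thesis by (simp add: b)
    qed
    moreover have "fps_nth (E_q_fps q) (Suc k) = T * q ^ k / (f * b)" "fps_nth (E_q_fps q) k = T / f"
      unfolding E_q_fps_def fps_nth_Abs_fps tri q_fact_Suc by (simp_all add: T_def f_def b_def power_add)
    ultimately show ?thesis
      unfolding Suc by (simp add: left_diff_distrib mult.assoc fps_nth_scale del: power_Suc)
  qed (simp add: fps_nth_scale left_diff_distrib mult.assoc)
qed

theorem e_q_fps_mult_E_q_fps_minus:
  assumes "norm q < 1"
  shows   "e_q_fps q * fps_scale (E_q_fps q) (-1) = 1"
proof (rule fps_eq_1_if_q_invariant[OF assms])
  have "fps_scale (e_q_fps q * fps_scale (E_q_fps q) (-1)) q =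
          fps_scale (e_q_fps q) q * fps_scale (E_q_fps q) (- q)"
    by (simp add: fps_scale_mult fps_scale_scale)
  thus "fps_scale (e_q_fps q * fps_scale (E_q_fps q) (-1)) q = e_q_fps q * fps_scale (E_q_fps q) (-1)"
    by (simp add: e_q_fps_scale[OF assms] E_q_fps_scale_minus[OF assms] mult_ac)
qed (simp add: fps_nth_scale)

section \<open>Formal generating functions of the two families\<close>

definition q_Genocchi_fps :: "complex \<Rightarrow> nat \<Rightarrow> complex \<Rightarrow> complex \<Rightarrow> complex fps" where
  "q_Genocchi_fps q \<alpha> x y = (2 * fps_X / (e_q_fps q + 1)) ^ \<alpha> *
     fps_scale (e_q_fps q) x * fps_scale (E_q_fps q) y"

definition q_Bernoulli_fps :: "complex \<Rightarrow> nat \<Rightarrow> complex \<Rightarrow> complex \<Rightarrow> complex fps" where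
  "q_Bernoulli_fps q \<alpha> x y = (fps_X / (e_q_fps q - 1)) ^ \<alpha> *
     fps_scale (e_q_fps q) x * fps_scale (E_q_fps q) y"

lemma q_Genocchi_eq_fps_nth:
  assumes q: "norm q < 1"
  shows   "q_Genocchi q \<alpha> n x y = fps_nth (q_Genocchi_fps q \<alpha> x y) n * q_fact q n"
proof -
  have "(\<lambda>t. (2 * t / (e_q q t + 1)) ^ \<alpha> * e_q q (t * x) * E_q q (t * y))
          has_fps_expansion q_Genocchi_fps q \<alpha> x y"
    unfolding q_Genocchi_fps_def
    by (intro fps_expansion_intros has_fps_expansion_compose_scale
          has_fps_expansion_e_q has_fps_expansion_E_q q) simp
  from sums_q_expansion_coeffs(1)[OF q this] show ?thesis
    by (simp add: q_Genocchi_def)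
qed

text \<open>Ensures that t / (e(t) - 1) is a power series: numerator and denominator both vanish to
  order exactly 1.\<close>

lemma subdegree_e_q_fps_minus_1:
  assumes "norm q < 1"
  shows   "subdegree (e_q_fps q - 1) = 1"
  using q_fact_nonzero[OF assms, of 1] by (intro subdegreeI) (auto simp: e_q_fps_def)

lemma q_Bernoulli_eq_fps_nth:
  assumes q: "norm q < 1"
  shows   "q_Bernoulli q \<alpha> n x y = fps_nth (q_Bernoulli_fps q \<alpha> x y) n * q_fact q n"
proof -
  \<comment> \<open>The limit of t / (e(t) - 1) at t = 0, which fills the removable
    singularity.\<close>
  define c where "c = 1 / fps_nth (e_q_fps q - 1) 1"
  have "e_q_fps q - 1 \<noteq> 0"
    using subdegree_e_q_fps_minus_1[OF q] by auto
  hence "(\<lambda>t. if t = 0 then c else t / (e_q q t - 1)) has_fps_expansion fps_X / (e_q_fps q - 1)"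
    using subdegree_e_q_fps_minus_1[OF q]
    by (intro fps_expansion_intros has_fps_expansion_e_q q) (auto simp: c_def)
  hence "(\<lambda>t. (if t = 0 then c else t / (e_q q t - 1)) ^ \<alpha> * e_q q (t * x) * E_q q (t * y))
           has_fps_expansion q_Bernoulli_fps q \<alpha> x y"
    unfolding q_Bernoulli_fps_def
    by (intro has_fps_expansion_mult has_fps_expansion_power has_fps_expansion_compose_scale
          has_fps_expansion_e_q has_fps_expansion_E_q q)
  from sums_q_expansion_coeffs(1)[OF q this] show ?thesis
    by (simp add: q_Bernoulli_def eventually_at_filter)
qed

section \<open>Functional equations of the generating functions\<close>

lemma q_Genocchi_fps_mult_E:
  "q_Genocchi_fps q \<alpha> x 0 * fps_scale (E_q_fps q) y = q_Genocchi_fps q \<alpha> x y"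
  by (simp add: q_Genocchi_fps_def)

lemma q_Genocchi_fps_nth_0:
  assumes "\<alpha> \<ge> 1"
  shows   "fps_nth (q_Genocchi_fps q \<alpha> x y) 0 = 0"
  using assms by (simp add: q_Genocchi_fps_def fps_divide_unit)

text \<open>Raising the order multiplies by 2t / (e(t) + 1), whose denominator is a unit with
  constant term 2.\<close>

lemma q_Genocchi_fps_Suc:
  "q_Genocchi_fps q (Suc \<alpha>) x y * (e_q_fps q + 1) = 2 * fps_X * q_Genocchi_fps q \<alpha> x y"
proof -
  define A :: "complex fps" where "A = 2 * fps_X / (e_q_fps q + 1)"
  have "A * (e_q_fps q + 1) = 2 * fps_X"
    by (simp add: A_def fps_divide_unit inverse_mult_eq_1 mult.assoc)
  hence "(A * (e_q_fps q + 1)) * (A ^ \<alpha> * fps_scale (e_q_fps q) x * fps_scale (E_q_fps q) y) =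
           2 * fps_X * (A ^ \<alpha> * fps_scale (e_q_fps q) x * fps_scale (E_q_fps q) y)"
    by (simp only:)
  thus ?thesis
    unfolding q_Genocchi_fps_def A_def [symmetric] by (simp only: power_Suc mult_ac)
qed

text \<open>Clearing e(t) + 1 leaves the factor e(t), which cancels the E(-t) coming from the
  argument -1.\<close>

lemma q_Genocchi_fps_recurrence:
  assumes "norm q < 1"
  shows   "2 * fps_X * q_Genocchi_fps q \<alpha> x (-1) - q_Genocchi_fps q (Suc \<alpha>) x (-1) =
             q_Genocchi_fps q (Suc \<alpha>) x 0"
proof -
  have "2 * fps_X * q_Genocchi_fps q \<alpha> x (-1) - q_Genocchi_fps q (Suc \<alpha>) x (-1) =
          q_Genocchi_fps q (Suc \<alpha>) x (-1) * e_q_fps q"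
    unfolding q_Genocchi_fps_Suc [symmetric] by (simp add: algebra_simps)
  also have "\<dots> = q_Genocchi_fps q (Suc \<alpha>) x 0 * (e_q_fps q * fps_scale (E_q_fps q) (-1))"
    by (simp add: q_Genocchi_fps_mult_E [symmetric, of q "Suc \<alpha>" x "-1"] mult_ac)
  finally show ?thesis by (simp add: e_q_fps_mult_E_q_fps_minus[OF assms])
qed

text \<open>The division by e(t) - 1 is exact, so it can be cleared before substituting ct for
  t.\<close>

lemma q_Bernoulli_fps_scale:
  assumes "norm q < 1"
  shows   "fps_scale (q_Bernoulli_fps q 1 0 y) c * (fps_scale (e_q_fps q) c - 1) =
             fps_const c * fps_X * fps_scale (E_q_fps q) (y * c)"
proof -
  have "e_q_fps q - 1 dvd fps_X"
    using subdegree_e_q_fps_minus_1[OF assms] by (subst fps_dvd_iff) auto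
  hence "fps_X / (e_q_fps q - 1) * (e_q_fps q - 1) = fps_X"
    by (rule dvd_div_mult_self)
  hence "q_Bernoulli_fps q 1 0 y * (e_q_fps q - 1) = fps_X * fps_scale (E_q_fps q) y"
    by (simp add: q_Bernoulli_fps_def mult.commute)
  hence "fps_scale (q_Bernoulli_fps q 1 0 y * (e_q_fps q - 1)) c =
           fps_scale (fps_X * fps_scale (E_q_fps q) y) c"
    by simp
  thus ?thesis
    by (simp add: fps_scale_mult fps_scale_scale fps_compose_sub_distrib mult_ac)
qed

text \<open>With q-factorial denominators, q-binomial convolution is the Cauchy product, and the
  weights 1 / c^i belong to e(t/c). This handles both inner sums of the theorem.\<close>

lemma q_binomial_sum_eq_fps_nth:
  assumes "norm q < 1"
  shows   "(\<Sum>j=0..k. q_binomial q k j * (1 / c ^ (k - j)) * (fps_nth F j * q_fact q j)) =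
             q_fact q k * fps_nth (fps_scale (e_q_fps q) (1 / c) * F) k"
  unfolding mult.commute[of "fps_scale _ _" F] fps_mult_nth sum_distrib_left
  using q_fact_nonzero[OF assms]
  by (intro sum.cong) (simp_all add: q_binomial_def fps_nth_scale e_q_fps_def power_divide)

theorem theorem3:
  fixes q x y :: complex and \<alpha> m n :: nat
  assumes "0 < norm q" "norm q < 1" and "\<alpha> \<ge> 1" and "m \<ge> 1"
  shows "q_Genocchi q \<alpha> n x y =
    (\<Sum>k=0..n. q_binomial q n k *
       (1 / (of_nat m powi (int n - int k - 1) * q_bracket q (k + 1))) *
       (2 * q_bracket q (k + 1) *
          (\<Sum>j=0..k. q_binomial q k j * (1 / of_nat m ^ (k - j)) * q_Genocchi q (\<alpha> - 1) j x (-1))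
        - (\<Sum>j=0..k+1. q_binomial q (k + 1) j * (1 / of_nat m ^ (k + 1 - j)) * q_Genocchi q \<alpha> j x (-1))
        - q_Genocchi q \<alpha> (k + 1) x 0) *
       q_Bernoulli q 1 (n - k) 0 (of_nat m * y))"
proof -
  note q = assms(2)
  define c :: complex where "c = of_nat m"
  have c: "c \<noteq> 0" using assms(4) by (simp add: c_def)
  obtain \<beta> where \<beta>: "\<alpha> = Suc \<beta>" using assms(3) by (cases \<alpha>) auto
  define e where "e = fps_scale (e_q_fps q) (1 / c)"
  \<comment> \<open>The generating function of the square bracket in the theorem, in the factored
    form that cancels against \<open>W\<close>.\<close>
  define H where "H = q_Genocchi_fps q \<alpha> x 0 * (e - 1)"
  define W where "W = fps_scale (q_Bernoulli_fps q 1 0 (c * y)) (1 / c)"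
  have H: "H = 2 * fps_X * (e * q_Genocchi_fps q \<beta> x (-1)) - e * q_Genocchi_fps q \<alpha> x (-1)
              - q_Genocchi_fps q \<alpha> x 0"
    unfolding H_def \<beta> q_Genocchi_fps_recurrence[OF q, symmetric] by (simp add: algebra_simps)
  have H0: "fps_nth H 0 = 0"
    by (simp add: H_def q_Genocchi_fps_nth_0[OF assms(3)])
  \<comment> \<open>The factor t lowers the index of the first term from k + 1 to k; its q-factorial
    then differs from the others by [k+1].\<close>
  have H_Suc: "2 * q_bracket q (k + 1) *
          (\<Sum>j=0..k. q_binomial q k j * (1 / c ^ (k - j)) * q_Genocchi q (\<alpha> - 1) j x (-1))
        - (\<Sum>j=0..k+1. q_binomial q (k + 1) j * (1 / c ^ (k + 1 - j)) * q_Genocchi q \<alpha> j x (-1))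
        - q_Genocchi q \<alpha> (k + 1) x 0 = q_fact q (Suc k) * fps_nth H (Suc k)" for k
  proof -
    have "fps_nth (2 * fps_X * F) (Suc k) = 2 * fps_nth F k" for F :: "complex fps"
      by (simp add: mult.assoc numeral_fps_const)
    thus ?thesis
      unfolding q_Genocchi_eq_fps_nth[OF q] q_binomial_sum_eq_fps_nth[OF q]
      by (simp add: H \<beta> e_def q_fact_Suc algebra_simps)
  qed
  \<comment> \<open>The factor e(t/m) - 1 of \<open>H\<close> is the denominator of
    \<open>W\<close>.\<close>
  have HW: "fps_const c * (H * W) = fps_X * q_Genocchi_fps q \<alpha> x y"
  proof -
    have "W * (e - 1) = fps_const (1 / c) * fps_X * fps_scale (E_q_fps q) y"
      using q_Bernoulli_fps_scale[OF q, of "c * y" "1 / c"] c by (simp add: W_def e_def)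
    hence "fps_const c * (q_Genocchi_fps q \<alpha> x 0 * (W * (e - 1))) =
             fps_const c * fps_const (1 / c) * fps_X *
               (q_Genocchi_fps q \<alpha> x 0 * fps_scale (E_q_fps q) y)"
      by (simp only: mult_ac)
    also have "\<dots> = fps_X * q_Genocchi_fps q \<alpha> x y"
      using c by (simp add: q_Genocchi_fps_mult_E)
    finally show ?thesis by (simp only: H_def mult_ac)
  qed
  have summand: "q_binomial q n k * (1 / (c powi (int n - int k - 1) * q_bracket q (k + 1))) *
      (q_fact q (Suc k) * fps_nth H (Suc k)) * q_Bernoulli q 1 (n - k) 0 (c * y) =
      q_fact q n * c * (fps_nth H (Suc k) * fps_nth W (n - k))" if "k \<in> {0..n}" for k
  proof -
    have "int n - int k = int (n - k)" using that by simp
    \<comment> \<open>The exponent is -1 when k = n, so the power is split as a natural power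
      divided by \<open>c\<close>.\<close>
    hence "c powi (int n - int k - 1) = c ^ (n - k) / c"
      using c by (simp only: power_int_diff power_int_of_nat power_int_1_right simp_thms)
    \<comment> \<open>To be read with F = [n]!, a = [k]!, b = [k+1], d = [n-k]! and p =
      c^(n-k).\<close>
    moreover have "F / (a * d) * (1 / (p / c * b)) * (a * b * h) * (w * d) = F * c * (h * (w / p))"
      if "a \<noteq> 0" "b \<noteq> 0" "d \<noteq> 0" "p \<noteq> 0" for F a b d p h w :: complex
      using that c by (simp add: divide_simps)
    moreover have "fps_nth W (n - k) = fps_nth (q_Bernoulli_fps q 1 0 (c * y)) (n - k) / c ^ (n - k)"
      by (simp add: W_def fps_nth_scale power_divide)
    moreover have "q_bracket q (k + 1) \<noteq> 0" "c ^ (n - k) \<noteq> 0"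
      using q_bracket_nonzero[OF q] c by auto
    ultimately show ?thesis
      using q_fact_nonzero[OF q]
      by (simp only: q_binomial_def q_Bernoulli_eq_fps_nth[OF q] q_fact_Suc[unfolded Suc_eq_plus1]
               Suc_eq_plus1 not_False_eq_True)
  qed
  have "q_Genocchi q \<alpha> n x y = q_fact q n * fps_nth (fps_X * q_Genocchi_fps q \<alpha> x y) (Suc n)"
    by (simp add: q_Genocchi_eq_fps_nth[OF q])
  \<comment> \<open>The Cauchy product at index n + 1 loses its first term because \<open>H\<close>
    has constant term 0; shifting the index gives a sum from 0 to n.\<close>
  also have "\<dots> = q_fact q n * c * (\<Sum>k=0..n. fps_nth H (Suc k) * fps_nth W (n - k))"
    unfolding HW [symmetric]
    by (simp add: fps_mult_nth[of H W] sum.atLeast_Suc_atMost[of 0 "Suc n"] sum.atLeast_Suc_atMost_Suc_shift H0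
             del: sum.cl_ivl_Suc)
  also have "\<dots> = (\<Sum>k=0..n. q_binomial q n k *
      (1 / (c powi (int n - int k - 1) * q_bracket q (k + 1))) *
      (q_fact q (Suc k) * fps_nth H (Suc k)) * q_Bernoulli q 1 (n - k) 0 (c * y))"
    unfolding sum_distrib_left by (intro sum.cong refl summand [symmetric])
  finally show ?thesis
    unfolding H_Suc [symmetric] c_def .
qed

end
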